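(* For every path of the process $Y=\{Y(t),t\ge0\}$ under consideration: 1) the set $\{t>0\mid Y(t)>0\}$ is open in the natural topology on $\mathbb R$; 2) $Y$ is continuous on $\{t\ge0\mid Y(t)>0\}$.
   Context: $B^H=\{B^H(t),t\ge0\}$ is a fractional Brownian motion with Hurst index $H\in(0,1/2)$ on a probability space $(\Omega,\mathcal F,\mathbb P)$, i.e. a centered Gaussian process with covariance $\mathbb E[B^H(t)B^H(s)]=\frac12(t^{2H}+s^{2H}-|t-s|^{2H})$ and continuous paths starting at $0$. $Y_0,k,a,\sigma>0$ are constants. For $\varepsilon>0$, $Y_\varepsilon=\{Y_\varepsilon(t),t\ge0\}$ is the unique (pathwise, continuous) solution of $$Y_\varepsilon(t)=Y_0+\int_0^t\frac{k}{Y_\varepsilon(s)\mathbf 1_{\{Y_\varepsilon(s)>0\}}+\varepsilon}\,ds-a\int_0^tY_\varepsilon(s)\,ds+\sigma B^H(t),\quad t\ge0.$$ $Y_\varepsilon(t)$ increases as $\varepsilon$ decreases, and $Y(t)=\lim_{\varepsilon\downarrow0}Y_\varepsilon(t)$, $t\ge0$, is the pointwise limit. Only finite and locally Lebesgue integrable paths of $Y$ are considered (this excludes only a null set). *)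

theory Defs
  imports "HOL-Probability.Probability"
begin

text \<open>Constants count as (degenerate) Gaussian random variables; this is needed because a
  fractional Brownian motion vanishes at time 0.\<close>

definition gaussian_rv :: "'a measure \<Rightarrow> ('a \<Rightarrow> real) \<Rightarrow> bool" where
  "gaussian_rv M X \<longleftrightarrow>
     X \<in> borel_measurable M \<and>
     (\<exists>\<mu>. (AE \<omega> in M. X \<omega> = \<mu>) \<or>
          (\<exists>s>0. distributed M lborel X (\<lambda>x. ennreal (normal_density \<mu> s x))))"

definition gaussian_process :: "'a measure \<Rightarrow> real set \<Rightarrow> (real \<Rightarrow> 'a \<Rightarrow> real) \<Rightarrow> bool" where
  "gaussian_process M T X \<longleftrightarrow>
     (\<forall>J c. finite J \<and> J \<subseteq> T \<longrightarrow> gaussian_rv M (\<lambda>\<omega>. \<Sum>t\<in>J. c t * X t \<omega>))"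

text \<open>Processes are indexed by \<open>real\<close>; only the times \<open>t \<ge> 0\<close> carry information. Continuity and
  the initial value are required of every path.\<close>

definition fractional_brownian_motion ::
    "'a measure \<Rightarrow> real \<Rightarrow> (real \<Rightarrow> 'a \<Rightarrow> real) \<Rightarrow> bool" where
  "fractional_brownian_motion M H B \<longleftrightarrow>
     prob_space M \<and>
     gaussian_process M {0..} B \<and>
     (\<forall>t\<ge>0. prob_space.expectation M (B t) = 0) \<and>
     (\<forall>t\<ge>0. \<forall>s\<ge>0. prob_space.expectation M (\<lambda>\<omega>. B t \<omega> * B s \<omega>) =
        1 / 2 * (t powr (2 * H) + s powr (2 * H) - \<bar>t - s\<bar> powr (2 * H))) \<and>
     (\<forall>\<omega>\<in>space M. continuous_on {0..} (\<lambda>t. B t \<omega>) \<and> B 0 \<omega> = 0)"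

text \<open>The continuous path \<open>y\<close> solves the approximating equation driven by the path \<open>b\<close>. For
  continuous \<open>y\<close> both integrands are continuous, so the gauge integral below is the Riemann and the
  Lebesgue integral.\<close>

definition solves_approx_eq ::
    "real \<Rightarrow> real \<Rightarrow> real \<Rightarrow> real \<Rightarrow> real \<Rightarrow> (real \<Rightarrow> real) \<Rightarrow> (real \<Rightarrow> real) \<Rightarrow> bool" where
  "solves_approx_eq Y0 k a \<sigma> \<epsilon> b y \<longleftrightarrow>
     continuous_on {0..} y \<and>
     (\<forall>t\<ge>0. y t = Y0
        + integral {0..t} (\<lambda>s. k / (y s * indicat_real {r. y r > 0} s + \<epsilon>))
        - a * integral {0..t} y
        + \<sigma> * b t)"

end

theory Submission imports Defs begin

text \<open>The argument is pathwise. Comparing drifts shows that \<open>Y\<epsilon> \<epsilon>\<close> grows as \<open>\<epsilon>\<close> decreases, so a positive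
  lower bound for one approximation near a point of positivity of the limit is a lower bound for all
  later ones; this gives openness. Where the approximations stay above \<open>c > 0\<close>, the drift is at most
  \<open>k / c\<close>, which bounds them uniformly from above as well. Hence their increments satisfy
  \<open>\<bar>y r - y s\<bar> \<le> L * \<bar>r - s\<bar> + \<sigma> * \<bar>b r - b s\<bar>\<close> with \<open>L\<close> independent of \<open>\<epsilon>\<close>, a bound
  that passes to the limit.\<close>

section \<open>The approximating equation in increment form\<close>

lemma solves_approx_eq_drift_continuous:
  assumes "solves_approx_eq Y0 k a \<sigma> \<epsilon> b y" "0 < \<epsilon>" "0 \<le> s"
  shows "continuous_on {s..t} (\<lambda>u. k / (max (y u) 0 + \<epsilon>) - a * y u)"
proof -
  have "continuous_on {s..t} y"
    using assms by (auto simp: solves_approx_eq_def intro: continuous_on_subset)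
  moreover have "max (y u) 0 + \<epsilon> \<noteq> 0" for u
    using assms(2) by (auto simp: max_def)
  ultimately show ?thesis
    by (intro continuous_intros) auto
qed

text \<open>Since \<open>y u * indicat_real {r. 0 < y r} u\<close> is just
  \<open>max (y u) 0\<close>, both integrands are continuous and merge into a single drift.
  Subtracting the equation at two times removes \<open>Y0\<close> and the past before
  \<open>s\<close>.\<close>

lemma solves_approx_eq_increment:
  assumes sol: "solves_approx_eq Y0 k a \<sigma> \<epsilon> b y" and "0 < \<epsilon>" "0 \<le> s" "s \<le> t"
  shows "y t - y s =
    integral {s..t} (\<lambda>u. k / (max (y u) 0 + \<epsilon>) - a * y u) + \<sigma> * (b t - b s)"
proof -
  let ?f = "\<lambda>u. k / (max (y u) 0 + \<epsilon>)"
  have pos: "max (y u) 0 + \<epsilon> \<noteq> 0" for u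
    using assms(2) by (auto simp: max_def)
  have max: "y u * indicat_real {r. 0 < y r} u = max (y u) 0" for u
    by (auto simp: indicator_def)
  have y: "continuous_on {0..v} y" for v
    using sol by (auto simp: solves_approx_eq_def intro: continuous_on_subset)
  have f: "continuous_on {0..v} ?f" for v
    by (intro continuous_intros y) (auto simp: pos)
  have eq: "y v = Y0 + integral {0..v} (\<lambda>u. ?f u - a * y u) + \<sigma> * b v" if "0 \<le> v" for v
  proof -
    have "integral {0..v} (\<lambda>u. ?f u - a * y u) = integral {0..v} ?f - a * integral {0..v} y"
      using y f
      by (subst integral_diff) (auto intro!: integrable_continuous_interval continuous_on_mult_left)
    then show ?thesis
      using sol that by (simp add: solves_approx_eq_def max)
  qed
  have "integral {0..s} (\<lambda>u. ?f u - a * y u) + integral {s..t} (\<lambda>u. ?f u - a * y u) =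
      integral {0..t} (\<lambda>u. ?f u - a * y u)"
    using assms solves_approx_eq_drift_continuous[OF sol]
    by (intro Henstock_Kurzweil_Integration.integral_combine integrable_continuous_interval) auto
  then show ?thesis
    using eq[of s] eq[of t] assms by (simp add: algebra_simps)
qed

section \<open>Comparison of solutions in the parameter\<close>

text \<open>The drift decreases both in the state and in the parameter. If \<open>y1\<close> were
  below \<open>y2\<close> at \<open>t\<close>, then from their last meeting time on
  \<open>y1\<close> would have the larger drift and the same noise, so it could not fall below
  \<open>y2\<close>.\<close>

lemma solves_approx_eq_antimono:
  assumes sol1: "solves_approx_eq Y0 k a \<sigma> \<epsilon>1 b y1" and sol2: "solves_approx_eq Y0 k a \<sigma> \<epsilon>2 b y2"
    and "0 < k" "0 < a" "0 < \<epsilon>1" "\<epsilon>1 \<le> \<epsilon>2" "0 \<le> t"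
  shows "y2 t \<le> y1 t"
proof (rule ccontr)
  assume "\<not> y2 t \<le> y1 t"
  define d where "d = (\<lambda>u. y1 u - y2 u)"
  let ?f = "\<lambda>y \<epsilon> u. k / (max (y u) 0 + \<epsilon>) - a * y u"
  have dt: "d t < 0"
    using \<open>\<not> y2 t \<le> y1 t\<close> by (simp add: d_def)
  have cont: "continuous_on {0..t} d"
    using sol1 sol2 unfolding d_def
    by (auto simp: solves_approx_eq_def intro!: continuous_intros intro: continuous_on_subset)
  have "d 0 = 0"
    using sol1 sol2 by (simp add: d_def solves_approx_eq_def)
  define S where "S = {u \<in> {0..t}. d u = 0}"
  have "0 \<in> S"
    using \<open>d 0 = 0\<close> \<open>0 \<le> t\<close> by (simp add: S_def)
  have "compact S"
    unfolding compact_eq_bounded_closed S_def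
    using continuous_closed_preimage_constant[OF cont, of 0]
    by (auto intro: bounded_subset[OF bounded_closed_interval[of 0 t]])
  then obtain s where "s \<in> S" and last: "\<And>u. u \<in> S \<Longrightarrow> u \<le> s"
    using compact_attains_sup[of S] \<open>0 \<in> S\<close> by blast
  then have s: "0 \<le> s" "s \<le> t" "d s = 0"
    by (auto simp: S_def)
  \<comment> \<open>A positive value at \<open>u\<close> together with \<open>d t < 0\<close> forces
    a zero in \<open>{u..t}\<close>. As \<open>s\<close> is the last zero, that zero can only be
    \<open>u\<close> itself.\<close>
  have neg: "d u \<le> 0" if u: "u \<in> {s..t}" for u
  proof (rule ccontr)
    assume "\<not> d u \<le> 0"
    moreover have "continuous_on {u..t} d"
      using cont by (rule continuous_on_subset) (use that s in auto)
    ultimately obtain v where "u \<le> v" "v \<le> t" "d v = 0"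
      using IVT2'[of d t 0 u] dt u by auto
    then have "v \<le> s"
      using last[of v] that s by (auto simp: S_def)
    then have "v = u"
      using \<open>u \<le> v\<close> u by auto
    then show False
      using \<open>d v = 0\<close> \<open>\<not> d u \<le> 0\<close> by simp
  qed
  have "integral {s..t} (?f y2 \<epsilon>2) \<le> integral {s..t} (?f y1 \<epsilon>1)"
  proof (rule integral_le)
    show "?f y2 \<epsilon>2 integrable_on {s..t}" "?f y1 \<epsilon>1 integrable_on {s..t}"
      using assms s by (auto intro!: integrable_continuous_interval
          intro: solves_approx_eq_drift_continuous[OF sol1] solves_approx_eq_drift_continuous[OF sol2])
    fix u assume "u \<in> {s..t}"
    then have "y1 u \<le> y2 u"
      using neg by (auto simp: d_def)
    then have "k / (max (y2 u) 0 + \<epsilon>2) \<le> k / (max (y1 u) 0 + \<epsilon>1)" "a * y1 u \<le> a * y2 u"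
      using assms by (auto intro!: divide_left_mono mult_pos_pos)
    then show "?f y2 \<epsilon>2 u \<le> ?f y1 \<epsilon>1 u"
      by linarith
  qed
  \<comment> \<open>Both solutions are driven by the same \<open>b\<close>, so the noise increments
    cancel in the difference.\<close>
  then have "d s \<le> d t"
    using solves_approx_eq_increment[OF sol1, of s t] solves_approx_eq_increment[OF sol2, of s t] assms s
    by (simp add: d_def)
  then show False
    using s dt by simp
qed

section \<open>Increment bounds uniform in the parameter\<close>

lemma integral_le_const_mult:
  fixes f :: "real \<Rightarrow> real"
  assumes "continuous_on {s..r} f" "s \<le> r" "\<And>u. u \<in> {s..r} \<Longrightarrow> f u \<le> D"
  shows "integral {s..r} f \<le> D * (r - s)"
proof -
  have "integral {s..r} f \<le> integral {s..r} (\<lambda>_. D)"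
    using assms by (intro integral_le integrable_continuous_interval) auto
  then show ?thesis
    using assms(2) by (simp add: mult.commute)
qed

text \<open>Above the level \<open>c\<close> the singular term is at most \<open>k / c\<close>
  whatever \<open>\<epsilon>\<close> is, and the mean reversion only pulls down.\<close>

lemma solves_approx_eq_increment_le:
  assumes sol: "solves_approx_eq Y0 k a \<sigma> \<epsilon> b y" and "0 < k" "0 < a" "0 < \<epsilon>" "0 \<le> s" "s \<le> r"
    and "0 < c" "\<And>u. u \<in> {s..r} \<Longrightarrow> c \<le> y u"
  shows "y r - y s \<le> k / c * (r - s) + \<sigma> * (b r - b s)"
proof -
  have "integral {s..r} (\<lambda>u. k / (max (y u) 0 + \<epsilon>) - a * y u) \<le> k / c * (r - s)"
  proof (intro integral_le_const_mult solves_approx_eq_drift_continuous[OF sol] assms)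
    fix u assume "u \<in> {s..r}"
    then have u: "c \<le> y u" using assms by auto
    then have "k / (max (y u) 0 + \<epsilon>) \<le> k / c"
      using assms by (intro divide_left_mono mult_pos_pos) auto
    moreover have "0 \<le> a * y u"
      using assms u by auto
    ultimately show "k / (max (y u) 0 + \<epsilon>) - a * y u \<le> k / c"
      by linarith
  qed
  then show ?thesis
    using solves_approx_eq_increment[OF sol, of s r] assms by linarith
qed

text \<open>The singular term only pushes up, so the downward drift comes from the mean reversion
  alone, whose strength is at most \<open>a * C\<close>.\<close>

lemma solves_approx_eq_increment_ge:
  assumes sol: "solves_approx_eq Y0 k a \<sigma> \<epsilon> b y" and "0 < k" "0 < a" "0 < \<epsilon>" "0 \<le> s" "s \<le> r"
    and "\<And>u. u \<in> {s..r} \<Longrightarrow> y u \<le> C"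
  shows "- (a * C * (r - s)) + \<sigma> * (b r - b s) \<le> y r - y s"
proof -
  let ?f = "\<lambda>u. k / (max (y u) 0 + \<epsilon>) - a * y u"
  have "integral {s..r} (\<lambda>u. - ?f u) \<le> a * C * (r - s)"
  proof (intro integral_le_const_mult continuous_on_minus
      solves_approx_eq_drift_continuous[OF sol] assms)
    fix u assume "u \<in> {s..r}"
    then have "a * y u \<le> a * C"
      using assms by auto
    moreover have "0 \<le> k / (max (y u) 0 + \<epsilon>)"
      using assms by (auto intro!: divide_nonneg_pos)
    ultimately show "- (k / (max (y u) 0 + \<epsilon>) - a * y u) \<le> a * C"
      by linarith
  qed
  then have "- (a * C * (r - s)) \<le> integral {s..r} ?f"
    by (simp only: integral_neg minus_le_iff)
  then show ?thesis
    using solves_approx_eq_increment[OF sol, of s r] assms by linarith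
qed

section \<open>Local estimates for the limit\<close>

text \<open>Positivity nearby yields openness, and the modulus in terms of \<open>b\<close> yields
  continuity. Neighbourhoods are taken within the half-line, so that \<open>t = 0\<close> is covered
  too.\<close>

lemma approx_eq_limit_local_bounds:
  assumes sol: "\<And>\<epsilon>. 0 < \<epsilon> \<Longrightarrow> solves_approx_eq Y0 k a \<sigma> \<epsilon> b (y \<epsilon>)"
    and lim: "\<And>t. 0 \<le> t \<Longrightarrow> ((\<lambda>\<epsilon>. y \<epsilon> t) \<longlongrightarrow> Z t) (at_right 0)"
    and pos: "0 < k" "0 < a" "0 < \<sigma>"
    and b: "continuous_on {0..} b"
    and t: "0 \<le> t" "0 < Z t"
  shows "\<exists>\<delta>>0. \<exists>L. \<forall>r\<ge>0. \<bar>r - t\<bar> < \<delta> \<longrightarrow>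
    0 < Z r \<and> \<bar>Z r - Z t\<bar> \<le> L * \<bar>r - t\<bar> + \<sigma> * \<bar>b r - b t\<bar>"
proof -
  have "\<forall>\<^sub>F \<epsilon> in at_right 0. 0 < y \<epsilon> t \<and> 0 < \<epsilon>"
    by (rule eventually_conj[OF order_tendstoD(1)[OF lim[OF t(1)] t(2)] eventually_at_right_less])
  then obtain \<epsilon>0 where \<epsilon>0: "0 < \<epsilon>0" "0 < y \<epsilon>0 t"
    by (blast dest: eventually_happens'[OF trivial_limit_at_right_real])
  \<comment> \<open>With half the value at \<open>t\<close>, an oscillation below \<open>c\<close>
    leaves \<open>y \<epsilon>0\<close> above \<open>c\<close>.\<close>
  define c where "c = y \<epsilon>0 t / 2"
  have c: "0 < c" "c < y \<epsilon>0 t"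
    using \<epsilon>0 by (auto simp: c_def)
  have "continuous_on {0..} (y \<epsilon>0)"
    using sol[OF \<epsilon>0(1)] by (simp add: solves_approx_eq_def)
  then have "\<exists>d>0. \<forall>r\<in>{0..}. dist r t < d \<longrightarrow> dist (y \<epsilon>0 r) (y \<epsilon>0 t) < c"
    using t(1) c(1) unfolding continuous_on_iff by blast
  then obtain \<delta> where \<delta>: "0 < \<delta>"
    and dist: "\<And>r. 0 \<le> r \<Longrightarrow> \<bar>r - t\<bar> < \<delta> \<Longrightarrow> \<bar>y \<epsilon>0 r - y \<epsilon>0 t\<bar> < c"
    by (auto simp: dist_real_def)
  have near: "c < y \<epsilon>0 r" if "0 \<le> r" "\<bar>r - t\<bar> < \<delta>" for r
    using dist[OF that] unfolding c_def by linarith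
  have low: "c \<le> y \<epsilon> r" if "0 < \<epsilon>" "\<epsilon> \<le> \<epsilon>0" "0 \<le> r" "\<bar>r - t\<bar> < \<delta>" for \<epsilon> r
    using solves_approx_eq_antimono[OF sol[OF that(1)] sol[OF \<epsilon>0(1)] pos(1,2) that(1-3)]
      near[OF that(3,4)] by linarith
  have ev: "\<forall>\<^sub>F \<epsilon> in at_right 0. 0 < \<epsilon> \<and> \<epsilon> \<le> \<epsilon>0"
    using \<epsilon>0(1) by (auto simp: eventually_at_right_field intro!: exI[of _ \<epsilon>0])
  have Zpos: "0 < Z r" if "0 \<le> r" "\<bar>r - t\<bar> < \<delta>" for r
  proof -
    \<comment> \<open>Strict positivity alone would be lost in the limit; the common bound
      \<open>c > 0\<close> survives.\<close>
    have "\<forall>\<^sub>F \<epsilon> in at_right 0. c \<le> y \<epsilon> r"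
      using ev by (rule eventually_mono) (use low that in blast)
    then have "c \<le> Z r"
      using lim[OF that(1)] by (intro tendsto_lowerbound[of _ _ "at_right 0"]) auto
    then show ?thesis using c(1) by linarith
  qed
  \<comment> \<open>A starting time strictly inside the neighbourhood, so that \<open>low\<close>
    applies from \<open>s0\<close> on, and cut off at 0, where the equation begins.\<close>
  define s0 where "s0 = max 0 (t - \<delta> / 2)"
  have s0: "0 \<le> s0" "s0 \<le> t" "\<And>u. s0 \<le> u \<Longrightarrow> t - \<delta> < u"
    using t \<delta> by (auto simp: s0_def)
  have "bounded (b ` {s0..t + \<delta>})"
    using b s0(1) by (intro compact_imp_bounded compact_continuous_image)
      (auto intro: continuous_on_subset)
  then have "\<exists>K. \<forall>u\<in>{s0..t + \<delta>}. \<bar>b u\<bar> \<le> K"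
    by (simp add: bounded_iff)
  then obtain K where K: "\<And>u. u \<in> {s0..t + \<delta>} \<Longrightarrow> \<bar>b u\<bar> \<le> K"
    by blast
  \<comment> \<open>an upper bound for the approximations, obtained by starting at \<open>s0\<close>, where they stay below \<open>Z s0\<close>\<close>
  define C where "C = Z s0 + k / c * (2 * \<delta>) + \<sigma> * (2 * K)"
  \<comment> \<open>By monotonicity the limit dominates every approximation. At \<open>s0\<close>
    this gives a bound on the starting value that is independent of
    \<open>\<epsilon>\<close>.\<close>
  have Zup: "y \<epsilon> r \<le> Z r" if "0 < \<epsilon>" "0 \<le> r" for \<epsilon> r
  proof -
    have "\<forall>\<^sub>F \<eta> in at_right 0. y \<epsilon> r \<le> y \<eta> r"
      unfolding eventually_at_right_field
      using that solves_approx_eq_antimono[OF sol sol[OF that(1)] pos(1,2)]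
      by (intro exI[of _ \<epsilon>]) auto
    then show ?thesis
      using lim[OF that(2)] by (intro tendsto_lowerbound[of _ _ "at_right 0"]) auto
  qed
  have up: "y \<epsilon> r \<le> C" if "0 < \<epsilon>" "\<epsilon> \<le> \<epsilon>0" "s0 \<le> r" "r < t + \<delta>" for \<epsilon> r
  proof -
    have "y \<epsilon> r - y \<epsilon> s0 \<le> k / c * (r - s0) + \<sigma> * (b r - b s0)"
    proof (rule solves_approx_eq_increment_le[OF sol[OF that(1)] pos(1,2) that(1) s0(1) that(3) c(1)])
      fix u assume "u \<in> {s0..r}"
      then show "c \<le> y \<epsilon> u"
        using that s0(1) s0(3)[of u] by (intro low) (auto simp: abs_less_iff)
    qed
    \<comment> \<open>Both times lie within \<open>\<delta>\<close> of \<open>t\<close>, and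
      \<open>K\<close> bounds \<open>b\<close> at each of them; hence the two factors 2 in
      \<open>C\<close>.\<close>
    moreover have "k / c * (r - s0) \<le> k / c * (2 * \<delta>)"
      using that s0(3)[of s0] pos c by (intro mult_left_mono) auto
    moreover have "\<sigma> * (b r - b s0) \<le> \<sigma> * (2 * K)"
      using K[of r] K[of s0] that s0 \<delta> pos by (intro mult_left_mono) auto
    ultimately show ?thesis
      using Zup[OF that(1) s0(1)] by (simp add: C_def)
  qed
  \<comment> \<open>The first entry limits the upward drift, the second the downward drift.\<close>
  define L where "L = max (k / c) (a * C)"
  have incr: "\<bar>y \<epsilon> r - y \<epsilon> s\<bar> \<le> L * (r - s) + \<sigma> * \<bar>b r - b s\<bar>"
    if "0 < \<epsilon>" "\<epsilon> \<le> \<epsilon>0" "s0 \<le> s" "s \<le> r" "r < t + \<delta>" for \<epsilon> r s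
  proof -
    have "y \<epsilon> r - y \<epsilon> s \<le> k / c * (r - s) + \<sigma> * (b r - b s)"
    proof (rule solves_approx_eq_increment_le[OF sol[OF that(1)] pos(1,2) that(1) _ that(4) c(1)])
      fix u assume "u \<in> {s..r}"
      then show "c \<le> y \<epsilon> u"
        using that s0(1) s0(3)[of u] by (intro low) (auto simp: abs_less_iff)
    qed (use that s0 in auto)
    moreover have "- (a * C * (r - s)) + \<sigma> * (b r - b s) \<le> y \<epsilon> r - y \<epsilon> s"
      by (rule solves_approx_eq_increment_ge[OF sol[OF that(1)] pos(1,2) that(1) _ that(4)])
         (use that s0 up in auto)
    moreover have "k / c * (r - s) \<le> L * (r - s)" "a * C * (r - s) \<le> L * (r - s)"
      using that by (auto simp: L_def simp del: times_divide_eq_left intro!: mult_right_mono)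
    moreover have "\<bar>\<sigma> * (b r - b s)\<bar> = \<sigma> * \<bar>b r - b s\<bar>"
      using pos by (simp add: abs_mult)
    ultimately show ?thesis by linarith
  qed
  show ?thesis
  proof (rule exI[of _ "\<delta> / 2"], intro conjI exI[of _ L] allI impI)
    fix r assume r: "0 \<le> r" "\<bar>r - t\<bar> < \<delta> / 2"
    then show "0 < Z r"
      using Zpos[of r] \<delta> by auto
    \<comment> \<open>Halving the radius keeps \<open>r\<close> to the right of \<open>s0\<close>,
      where \<open>incr\<close> is available.\<close>
    have "s0 \<le> r" "r < t + \<delta>"
      using r \<delta> unfolding s0_def by linarith+
    have "\<bar>y \<epsilon> r - y \<epsilon> t\<bar> \<le> L * \<bar>r - t\<bar> + \<sigma> * \<bar>b r - b t\<bar>" if "0 < \<epsilon>" "\<epsilon> \<le> \<epsilon>0" for \<epsilon>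
    proof (cases "t \<le> r")
      case True
      then show ?thesis
        using incr[OF that s0(2) True \<open>r < t + \<delta>\<close>] by simp
    next
      case False
      then show ?thesis
        using incr[OF that \<open>s0 \<le> r\<close>, of t] \<delta> by (simp add: abs_minus_commute)
    qed
    then have "\<forall>\<^sub>F \<epsilon> in at_right 0. \<bar>y \<epsilon> r - y \<epsilon> t\<bar> \<le> L * \<bar>r - t\<bar> + \<sigma> * \<bar>b r - b t\<bar>"
      using eventually_mono[OF ev] by simp
    moreover have "((\<lambda>\<epsilon>. \<bar>y \<epsilon> r - y \<epsilon> t\<bar>) \<longlongrightarrow> \<bar>Z r - Z t\<bar>) (at_right 0)"
      by (intro tendsto_intros lim r t)
    ultimately show "\<bar>Z r - Z t\<bar> \<le> L * \<bar>r - t\<bar> + \<sigma> * \<bar>b r - b t\<bar>"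
      by (intro tendsto_upperbound[of _ _ "at_right 0"]) auto
  qed (use \<delta> in auto)
qed

section \<open>Openness and continuity for the paths of the limit process\<close>

theorem theorem3p1:
  fixes M :: "'a measure" and B :: "real \<Rightarrow> 'a \<Rightarrow> real" and H Y0 k a \<sigma> :: real
    and Y\<epsilon> :: "real \<Rightarrow> real \<Rightarrow> 'a \<Rightarrow> real" and Y :: "real \<Rightarrow> 'a \<Rightarrow> ereal"
  assumes "0 < H" "H < 1 / 2"
    and "fractional_brownian_motion M H B"
    and "0 < Y0" "0 < k" "0 < a" "0 < \<sigma>"
    and "\<And>\<epsilon> \<omega>. 0 < \<epsilon> \<Longrightarrow> \<omega> \<in> space M \<Longrightarrow>
           solves_approx_eq Y0 k a \<sigma> \<epsilon> (\<lambda>t. B t \<omega>) (\<lambda>t. Y\<epsilon> \<epsilon> t \<omega>)"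
    and "\<And>t \<omega>. 0 \<le> t \<Longrightarrow> \<omega> \<in> space M \<Longrightarrow>
           ((\<lambda>\<epsilon>. ereal (Y\<epsilon> \<epsilon> t \<omega>)) \<longlongrightarrow> Y t \<omega>) (at_right 0)"
    and "\<omega> \<in> space M"
    and "\<And>t. 0 \<le> t \<Longrightarrow> \<bar>Y t \<omega>\<bar> \<noteq> \<infinity>"
    and "\<And>T. 0 < T \<Longrightarrow> (\<lambda>t. real_of_ereal (Y t \<omega>)) absolutely_integrable_on {0..T}"
  shows "open {t. 0 < t \<and> 0 < Y t \<omega>} \<and>
    continuous_on {t. 0 \<le> t \<and> 0 < Y t \<omega>} (\<lambda>t. real_of_ereal (Y t \<omega>))"
proof -
  \<comment> \<open>The limit is a priori extended-valued; finiteness of the path allows the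
    estimates to be used with a real-valued limit.\<close>
  define Z where "Z t = real_of_ereal (Y t \<omega>)" for t
  have Y: "Y t \<omega> = ereal (Z t)" if "0 \<le> t" for t
    using assms(11)[OF that] by (simp add: Z_def ereal_real)
  have lim: "((\<lambda>\<epsilon>. Y\<epsilon> \<epsilon> t \<omega>) \<longlongrightarrow> Z t) (at_right 0)" if "0 \<le> t" for t
    using assms(9)[OF that assms(10)] by (simp add: Y[OF that])
  have b: "continuous_on {0..} (\<lambda>t. B t \<omega>)"
    using assms(3,10) by (simp add: fractional_brownian_motion_def)
  note bounds = approx_eq_limit_local_bounds[where y = "\<lambda>\<epsilon> t. Y\<epsilon> \<epsilon> t \<omega>" and b = "\<lambda>t. B t \<omega>",
      OF assms(8)[OF _ assms(10)] lim assms(5-7) b]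
  have "open {t. 0 < t \<and> 0 < Y t \<omega>}"
    unfolding open_dist
  proof safe
    fix t assume t: "0 < t" "0 < Y t \<omega>"
    then have "0 \<le> t" "0 < Z t"
      using Y[of t] by auto
    obtain \<delta> where \<delta>: "0 < \<delta>" "\<And>r. 0 \<le> r \<Longrightarrow> \<bar>r - t\<bar> < \<delta> \<Longrightarrow> 0 < Z r"
      using bounds[OF _ _ \<open>0 \<le> t\<close> \<open>0 < Z t\<close>] by blast
    \<comment> \<open>The radius is also at most \<open>t\<close>, which keeps \<open>r\<close>
      positive.\<close>
    have "0 < r \<and> 0 < Y r \<omega>" if "dist r t < min \<delta> t" for r
      using that \<delta>(2)[of r] Y[of r] by (auto simp: dist_real_def)
    then show "\<exists>e>0. \<forall>r. dist r t < e \<longrightarrow> r \<in> {t. 0 < t \<and> 0 < Y t \<omega>}"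
      using \<delta>(1) t(1) by (intro exI[of _ "min \<delta> t"]) auto
  qed
  moreover have "continuous_on {t. 0 \<le> t \<and> 0 < Y t \<omega>} Z"
    unfolding continuous_on_def
  proof
    let ?A = "{t. 0 \<le> t \<and> 0 < Y t \<omega>}"
    fix t assume "t \<in> ?A"
    then have t: "0 \<le> t" "0 < Z t"
      using Y[of t] by auto
    obtain \<delta> L where \<delta>: "0 < \<delta>"
      "\<And>r. 0 \<le> r \<Longrightarrow> \<bar>r - t\<bar> < \<delta> \<Longrightarrow> \<bar>Z r - Z t\<bar> \<le> L * \<bar>r - t\<bar> + \<sigma> * \<bar>B r \<omega> - B t \<omega>\<bar>"
      using bounds[OF _ _ t] by blast
    \<comment> \<open>Squeeze argument: the majorant vanishes as \<open>r\<close> tends to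
      \<open>t\<close> because the path of \<open>B\<close> is continuous on the half-line.\<close>
    have "\<forall>\<^sub>F r in at t within ?A. norm (Z r - Z t) \<le> L * \<bar>r - t\<bar> + \<sigma> * \<bar>B r \<omega> - B t \<omega>\<bar>"
      unfolding eventually_at using \<delta> by (intro exI[of _ \<delta>]) (auto simp: dist_real_def)
    moreover have "((\<lambda>r. L * \<bar>r - t\<bar> + \<sigma> * \<bar>B r \<omega> - B t \<omega>\<bar>) \<longlongrightarrow> 0) (at t within ?A)"
    proof -
      have "((\<lambda>r. B r \<omega>) \<longlongrightarrow> B t \<omega>) (at t within ?A)"
        by (rule tendsto_within_subset[of _ _ _ "{0..}"]) (use b t(1) in \<open>auto simp: continuous_on_def\<close>)
      then have "((\<lambda>r. L * \<bar>r - t\<bar> + \<sigma> * \<bar>B r \<omega> - B t \<omega>\<bar>) \<longlongrightarrow>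
          L * \<bar>t - t\<bar> + \<sigma> * \<bar>B t \<omega> - B t \<omega>\<bar>) (at t within ?A)"
        by (intro tendsto_intros)
      then show ?thesis by simp
    qed
    ultimately have "((\<lambda>r. Z r - Z t) \<longlongrightarrow> 0) (at t within ?A)"
      by (rule Lim_null_comparison)
    then show "(Z \<longlongrightarrow> Z t) (at t within ?A)"
      by (rule LIM_zero_cancel)
  qed
  ultimately show ?thesis
    by (simp add: Z_def)
qed

end
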